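(* Given any $\alpha \in (0,1)$ and $\rho \in (0,1]$, $$\lim_{n \to \infty} FWER(n, \alpha, \rho) = 0.$$
   Context: Let $\Phi$ denote the cumulative distribution function of the standard normal distribution. For each $n \ge 1$ consider jointly normal random variables $X_1,\ldots,X_n$ with $X_i \sim \mathcal{N}(\mu_i,1)$ and $\operatorname{Corr}(X_i,X_j)=\rho$ for all $i\neq j$, where $\rho\in[0,1]$. The null hypotheses are $H_{0i}:\mu_i=0$, and the global null is $H_0=\bigcap_{i=1}^n H_{0i}$, i.e. all $\mu_i=0$. Thus under $H_0$ the vector $(X_1,\ldots,X_n)$ has the (possibly degenerate) distribution $N_n(\mathbf{0},(1-\rho)I_n+\rho J_n)$, where $I_n$ is the identity matrix and $J_n$ is the $n\times n$ matrix of all ones. For $\alpha\in(0,1)$ the one-sided Bonferroni method rejects $H_{0i}$ if $X_i>c_{\alpha,n}$, where $c_{\alpha,n}=\Phi^{-1}(1-\alpha/n)$. Its familywise error rate is $$FWER(n,\alpha,\rho)=\mathbb{P}_{H_0}\Big(\bigcup_{i=1}^n\{X_i>c_{\alpha,n}\}\Big).$$ *)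

theory Defs
  imports "HOL-Probability.Probability"
begin

(* N(m, v), parametrised by its variance v; for v = 0 it is the point mass at m. *)
definition normal_law :: "real \<Rightarrow> real \<Rightarrow> real measure" where
  "normal_law m v =
     (if v = 0 then return borel m else density lborel (normal_density m (sqrt v)))"

(* The joint law may be degenerate: some linear combinations may be almost surely constant. *)
definition jointly_normal :: "'a measure \<Rightarrow> 'i set \<Rightarrow> ('i \<Rightarrow> 'a \<Rightarrow> real) \<Rightarrow> bool" where
  "jointly_normal M I X \<longleftrightarrow>
     prob_space M \<and> finite I \<and> (\<forall>i\<in>I. X i \<in> borel_measurable M) \<and>
     (\<forall>a :: 'i \<Rightarrow> real. \<exists>m v. v \<ge> 0 \<and>
        distr M borel (\<lambda>\<omega>. \<Sum>i\<in>I. a i * X i \<omega>) = normal_law m v)"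

definition covariance :: "'a measure \<Rightarrow> ('a \<Rightarrow> real) \<Rightarrow> ('a \<Rightarrow> real) \<Rightarrow> real" where
  "covariance M X Y =
     (LINT \<omega>|M. (X \<omega> - (LINT \<omega>'|M. X \<omega>')) * (Y \<omega> - (LINT \<omega>'|M. Y \<omega>')))"

definition correlation :: "'a measure \<Rightarrow> ('a \<Rightarrow> real) \<Rightarrow> ('a \<Rightarrow> real) \<Rightarrow> real" where
  "correlation M X Y = covariance M X Y / sqrt (covariance M X X * covariance M Y Y)"

definition equicorrelated_normal ::
    "'a measure \<Rightarrow> nat \<Rightarrow> (nat \<Rightarrow> 'a \<Rightarrow> real) \<Rightarrow> (nat \<Rightarrow> real) \<Rightarrow> real \<Rightarrow> bool" where
  "equicorrelated_normal M n X \<mu> \<rho> \<longleftrightarrow>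
     jointly_normal M {1..n} X \<and>
     (\<forall>i\<in>{1..n}. distr M borel (X i) = normal_law (\<mu> i) 1) \<and>
     (\<forall>i\<in>{1..n}. \<forall>j\<in>{1..n}. i \<noteq> j \<longrightarrow> correlation M (X i) (X j) = \<rho>)"

definition global_null :: "nat \<Rightarrow> (nat \<Rightarrow> real) \<Rightarrow> bool" where
  "global_null n \<mu> \<longleftrightarrow> (\<forall>i\<in>{1..n}. \<mu> i = 0)"

definition std_normal_cdf :: "real \<Rightarrow> real" where
  "std_normal_cdf = cdf std_normal_distribution"

(* std_normal_cdf is a bijection from the reals onto the open interval (0,1), so inv is its
   inverse there; the argument 1 - \<alpha>/n lies in that interval for 0 < \<alpha> < 1 and n \<ge> 1. *)
definition bonferroni_cutoff :: "real \<Rightarrow> nat \<Rightarrow> real" where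
  "bonferroni_cutoff \<alpha> n = inv std_normal_cdf (1 - \<alpha> / real n)"

(* The familywise error rate when (M, X) is a realisation of the model under the global null. *)
definition FWER :: "'a measure \<Rightarrow> (nat \<Rightarrow> 'a \<Rightarrow> real) \<Rightarrow> nat \<Rightarrow> real \<Rightarrow> real" where
  "FWER M X n \<alpha> =
     measure M (\<Union>i\<in>{1..n}. {\<omega> \<in> space M. X i \<omega> > bonferroni_cutoff \<alpha> n})"

end

theory Submission
  imports Defs "HOL-Real_Asymp.Real_Asymp"
begin

text \<open>
  Write \<open>S\<close> for the mean of the \<open>X\<^sub>i\<close>. Both \<open>S\<close> and \<open>X\<^sub>i - S\<close> are linear combinations of jointly
  normal variables, hence centred normal, with variances at most \<open>1\<close> and \<open>1 - \<rho>\<close>. If some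
  \<open>X\<^sub>i\<close> exceeds the cutoff \<open>c\<close>, then \<open>S > (1 - d) c\<close> or some \<open>X\<^sub>i - S > d c\<close>. For fixed \<open>d < 1\<close> the first
  event has vanishing probability as \<open>c \<rightarrow> \<infinity>\<close>. For the second, the union bound
  \<open>n exp (- d\<^sup>2 c\<^sup>2 / (2 w))\<close> suffices with \<open>1 - \<rho> \<le> w < d\<^sup>2\<close>, because \<open>\<alpha> / n = 1 - \<Phi> c\<close> is at least the
  normal density at \<open>c + 1\<close>, so \<open>n\<close> grows no faster than \<open>exp ((c + 1)\<^sup>2 / 2)\<close>.
\<close>

section \<open>Normal laws: moments and tails\<close>

lemma space_normal_law [simp]: "space (normal_law m v) = UNIV"
  and sets_normal_law [simp, measurable_cong]: "sets (normal_law m v) = sets borel"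
  by (auto simp: normal_law_def)

text \<open>Joint normality only asserts that parameters exist for each linear combination; these
  formulas identify them as mean and variance. The point mass has no density and is treated
  separately.\<close>

lemma normal_law_moments:
  assumes "v \<ge> 0"
  shows integrable_normal_law: "integrable (normal_law m v) (\<lambda>x. x)"
    and integral_normal_law: "(LINT x|normal_law m v. x) = m"
    and integrable_normal_law_square: "integrable (normal_law m v) (\<lambda>x. (x - m)\<^sup>2)"
    and integral_normal_law_square: "(LINT x|normal_law m v. (x - m)\<^sup>2) = v"
proof -
  have "integrable (normal_law m v) (\<lambda>x. x) \<and> (LINT x|normal_law m v. x) = m \<and>
    integrable (normal_law m v) (\<lambda>x. (x - m)\<^sup>2) \<and> (LINT x|normal_law m v. (x - m)\<^sup>2) = v"
  proof (cases "v = 0")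
    case True
    have r: "integrable (return borel m) f" if "f \<in> borel_measurable borel" for f :: "real \<Rightarrow> real"
      using that by (subst integrable_iff_bounded) (auto simp: nn_integral_return)
    show ?thesis
      using True by (auto simp: normal_law_def integral_return intro!: r)
  next
    case False
    with assms have pos: "sqrt v > 0" by simp
    have law: "normal_law m v = density lborel (normal_density m (sqrt v))"
      using False by (simp add: normal_law_def)
    show ?thesis
      unfolding law
      using integrable_normal_moment_nz_1[OF pos, of m] integral_normal_moment_nz_1[OF pos, of m]
        integrable_normal_moment[OF pos, of m 2] integral_normal_moment_even[OF pos, of m 1] assms
      by (simp add: integrable_density integral_density fact_numeral)
  qed
  then show "integrable (normal_law m v) (\<lambda>x. x)" "(LINT x|normal_law m v. x) = m"
    "integrable (normal_law m v) (\<lambda>x. (x - m)\<^sup>2)" "(LINT x|normal_law m v. (x - m)\<^sup>2) = v"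
    by auto
qed

text \<open>A positive majorant \<open>w\<close> of the variance keeps the bound meaningful for the
  point mass, which gives no mass to \<open>{x<..}\<close> because \<open>0 \<le> x\<close>.\<close>

lemma normal_law_tail_bound:
  assumes "0 \<le> v" "v \<le> w" "0 < w" "0 \<le> x"
  shows "measure (normal_law 0 v) {x<..} \<le> exp (- x\<^sup>2 / (2 * w))"
proof (cases "v = 0")
  case True
  then show ?thesis using assms by (simp add: normal_law_def measure_return)
next
  case False
  with assms have "v > 0" by simp
  let ?e = "exp (- x\<^sup>2 / (2 * v))"
  \<comment> \<open>Beyond \<open>x\<close>, the density is at most \<open>?e\<close> times the density recentred at \<open>x\<close>,
    since \<open>t\<^sup>2 \<ge> x\<^sup>2 + (t - x)\<^sup>2\<close> for \<open>t \<ge> x \<ge> 0\<close>.\<close>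
  have pt: "normal_density 0 (sqrt v) t \<le> ?e * normal_density x (sqrt v) t" if "x < t" for t
  proof -
    have "0 \<le> x * (t - x)" using that assms by simp
    then have "- t\<^sup>2 \<le> - x\<^sup>2 + - (t - x)\<^sup>2"
      by (simp add: power2_eq_square algebra_simps)
    then have "- t\<^sup>2 / (2 * v) \<le> (- x\<^sup>2 + - (t - x)\<^sup>2) / (2 * v)"
      using \<open>v > 0\<close> by (intro divide_right_mono) auto
    then have "exp (- t\<^sup>2 / (2 * v)) \<le> ?e * exp (- (t - x)\<^sup>2 / (2 * v))"
      by (simp add: exp_add[symmetric] add_divide_distrib diff_divide_distrib)
    from mult_left_mono[OF this, of "1 / sqrt (2 * pi * v)"] show ?thesis
      using \<open>v > 0\<close> by (simp add: normal_density_def mult_ac)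
  qed
  have "emeasure (normal_law 0 v) {x<..}
      = (\<integral>\<^sup>+t. ennreal (normal_density 0 (sqrt v) t) * indicator {x<..} t \<partial>lborel)"
    using False by (simp add: normal_law_def emeasure_density)
  also have "\<dots> \<le> (\<integral>\<^sup>+t. ennreal ?e * ennreal (normal_density x (sqrt v) t) \<partial>lborel)"
    using pt by (intro nn_integral_mono) (auto simp: indicator_def ennreal_mult[symmetric] intro!: ennreal_leI)
  also have "\<dots> = ennreal ?e"
    using \<open>v > 0\<close> by (simp add: nn_integral_cmult nn_integral_eq_integral)
  finally have "measure (normal_law 0 v) {x<..} \<le> ?e"
    by (simp add: measure_def enn2real_leI)
  also have "?e \<le> exp (- x\<^sup>2 / (2 * w))"
    using assms \<open>v > 0\<close> by (simp add: frac_le)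
  finally show ?thesis .
qed

section \<open>Linear combinations in the equicorrelated model\<close>

text \<open>At the global null all means vanish and all variances are 1, so each correlation is
  already the mixed second moment.\<close>

lemma equicorrelated_normal_second_moments:
  assumes model: "equicorrelated_normal M n X \<mu> \<rho>" and null: "global_null n \<mu>"
    and "i \<in> {1..n}" "j \<in> {1..n}"
  shows "integrable M (\<lambda>\<omega>. X i \<omega> * X j \<omega>)"
    and "(LINT \<omega>|M. X i \<omega> * X j \<omega>) = (if i = j then 1 else \<rho>)"
    and "integrable M (X i)"
    and "(LINT \<omega>|M. X i \<omega>) = 0"
proof -
  have X: "X k \<in> borel_measurable M" and law: "distr M borel (X k) = normal_law 0 1"
    if "k \<in> {1..n}" for k
    using that assms(1,2)
    by (auto simp: equicorrelated_normal_def jointly_normal_def global_null_def)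
  have int: "integrable M (X k)" and sq: "integrable M (\<lambda>\<omega>. (X k \<omega>)\<^sup>2)" and
    mean: "(LINT \<omega>|M. X k \<omega>) = 0" and var: "(LINT \<omega>|M. (X k \<omega>)\<^sup>2) = 1" if k: "k \<in> {1..n}" for k
  proof -
    note [measurable] = X[OF k]
    show "integrable M (X k)"
      using integrable_normal_law[OF zero_le_one, of 0] unfolding law[OF k, symmetric]
      by (subst (asm) integrable_distr_eq) auto
    show "integrable M (\<lambda>\<omega>. (X k \<omega>)\<^sup>2)"
      using integrable_normal_law_square[OF zero_le_one, of 0] unfolding law[OF k, symmetric]
      by (subst (asm) integrable_distr_eq) auto
    show "(LINT \<omega>|M. X k \<omega>) = 0"
      using integral_normal_law[OF zero_le_one, of 0] unfolding law[OF k, symmetric]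
      by (subst (asm) integral_distr) auto
    show "(LINT \<omega>|M. (X k \<omega>)\<^sup>2) = 1"
      using integral_normal_law_square[OF zero_le_one, of 0] unfolding law[OF k, symmetric]
      by (subst (asm) integral_distr) auto
  qed
  note [measurable] = X[OF assms(3)] X[OF assms(4)]
  show "integrable M (X i)" "(LINT \<omega>|M. X i \<omega>) = 0"
    using int mean assms by auto
  \<comment> \<open>Domination by the sum of squares reduces integrability of the product to finite
    variances.\<close>
  show "integrable M (\<lambda>\<omega>. X i \<omega> * X j \<omega>)"
  proof (rule Bochner_Integration.integrable_bound)
    show "integrable M (\<lambda>\<omega>. (X i \<omega>)\<^sup>2 + (X j \<omega>)\<^sup>2)" using sq assms by auto
    have "\<bar>x * y\<bar> \<le> x\<^sup>2 + y\<^sup>2" for x y :: real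
      using sum_squares_bound[of "\<bar>x\<bar>" "\<bar>y\<bar>"] mult_nonneg_nonneg[of "\<bar>x\<bar>" "\<bar>y\<bar>"]
      unfolding abs_mult power2_abs by linarith
    then show "AE \<omega> in M. norm (X i \<omega> * X j \<omega>) \<le> norm ((X i \<omega>)\<^sup>2 + (X j \<omega>)\<^sup>2)"
      by auto
  qed measurable
  show "(LINT \<omega>|M. X i \<omega> * X j \<omega>) = (if i = j then 1 else \<rho>)"
  proof (cases "i = j")
    case True
    then show ?thesis using var[OF assms(3)] by (simp add: power2_eq_square)
  next
    case False
    then have "correlation M (X i) (X j) = \<rho>"
      using assms by (auto simp: equicorrelated_normal_def)
    then show ?thesis
      using False mean[OF assms(3)] mean[OF assms(4)] var[OF assms(3)] var[OF assms(4)]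
      by (simp add: correlation_def covariance_def power2_eq_square)
  qed
qed

text \<open>\<open>v a\<close> is the quadratic form of the covariance matrix. The combination is
  normal by assumption, so its first two moments determine its law, and \<open>v a\<close> is
  nonnegative as a variance.\<close>

lemma equicorrelated_normal_linear_combination:
  assumes model: "equicorrelated_normal M n X \<mu> \<rho>" and null: "global_null n \<mu>"
  defines "v \<equiv> \<lambda>a. (1 - \<rho>) * (\<Sum>i\<in>{1..n}. (a i)\<^sup>2) + \<rho> * (\<Sum>i\<in>{1..n}. a i)\<^sup>2"
  shows "distr M borel (\<lambda>\<omega>. \<Sum>i\<in>{1..n}. a i * X i \<omega>) = normal_law 0 (v a)"
    and "v a \<ge> 0"
proof -
  let ?W = "\<lambda>\<omega>. \<Sum>i\<in>{1..n}. a i * X i \<omega>"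
  note mom = equicorrelated_normal_second_moments[OF model null]
  have X [measurable]: "X k \<in> borel_measurable M" if "k \<in> {1..n}" for k
    using that model by (auto simp: equicorrelated_normal_def jointly_normal_def)
  obtain m u where u: "u \<ge> 0" and law: "distr M borel ?W = normal_law m u"
    using model unfolding equicorrelated_normal_def jointly_normal_def by meson
  have W [measurable]: "?W \<in> borel_measurable M" by measurable
  have "m = (LINT \<omega>|M. ?W \<omega>)"
    using integral_normal_law[OF u, of m] unfolding law[symmetric]
    by (subst (asm) integral_distr) auto
  also have "\<dots> = 0"
    by (subst Bochner_Integration.integral_sum) (auto simp: mom)
  finally have m: "m = 0" .
  have "u = (LINT \<omega>|M. (?W \<omega>)\<^sup>2)"
    using integral_normal_law_square[OF u, of m] unfolding law[symmetric] unfolding m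
    by (subst (asm) integral_distr) auto
  also have "\<dots> = (LINT \<omega>|M. (\<Sum>i\<in>{1..n}. \<Sum>j\<in>{1..n}. (a i * a j) * (X i \<omega> * X j \<omega>)))"
    by (simp add: power2_eq_square sum_product mult_ac)
  also have "\<dots> = (\<Sum>i\<in>{1..n}. \<Sum>j\<in>{1..n}. (a i * a j) * (if i = j then 1 else \<rho>))"
  proof -
    have "(LINT \<omega>|M. (\<Sum>i\<in>{1..n}. \<Sum>j\<in>{1..n}. (a i * a j) * (X i \<omega> * X j \<omega>)))
      = (\<Sum>i\<in>{1..n}. LINT \<omega>|M. (\<Sum>j\<in>{1..n}. (a i * a j) * (X i \<omega> * X j \<omega>)))"
      by (intro Bochner_Integration.integral_sum Bochner_Integration.integrable_sum
          integrable_mult_right mom(1))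
    also have "\<dots> = (\<Sum>i\<in>{1..n}. \<Sum>j\<in>{1..n}. LINT \<omega>|M. (a i * a j) * (X i \<omega> * X j \<omega>))"
      by (intro sum.cong refl Bochner_Integration.integral_sum integrable_mult_right mom(1))
    finally show ?thesis by (simp add: mom(2) cong: sum.cong_simp)
  qed
  \<comment> \<open>The covariance matrix splits into \<open>1 - \<rho>\<close> times the identity
    and \<open>\<rho>\<close> times the all-ones matrix.\<close>
  also have "\<dots> = (\<Sum>i\<in>{1..n}. \<Sum>j\<in>{1..n}. (1 - \<rho>) * (if i = j then (a i)\<^sup>2 else 0) + \<rho> * (a i * a j))"
    by (intro sum.cong refl) (auto simp: power2_eq_square algebra_simps)
  also have "\<dots> = v a"
    by (simp add: v_def sum.distrib sum_distrib_left[symmetric] sum_product power2_eq_square)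
  finally have "u = v a" .
  then show "distr M borel ?W = normal_law 0 (v a)" "v a \<ge> 0"
    using law u m by auto
qed

lemma equicorrelated_normal_combination_tail:
  assumes model: "equicorrelated_normal M n X \<mu> \<rho>" and null: "global_null n \<mu>"
    and "(1 - \<rho>) * (\<Sum>i\<in>{1..n}. (a i)\<^sup>2) + \<rho> * (\<Sum>i\<in>{1..n}. a i)\<^sup>2 \<le> w" "0 < w" "0 \<le> x"
  shows "measure M {\<omega> \<in> space M. x < (\<Sum>i\<in>{1..n}. a i * X i \<omega>)} \<le> exp (- x\<^sup>2 / (2 * w))"
proof -
  let ?W = "\<lambda>\<omega>. \<Sum>i\<in>{1..n}. a i * X i \<omega>"
  have [measurable]: "X k \<in> borel_measurable M" if "k \<in> {1..n}" for k
    using that model by (auto simp: equicorrelated_normal_def jointly_normal_def)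
  have W [measurable]: "?W \<in> borel_measurable M" by measurable
  have "measure M {\<omega> \<in> space M. x < ?W \<omega>} = measure (distr M borel ?W) {x<..}"
    by (subst measure_distr) (auto intro!: arg_cong[where f = "measure M"])
  also have "\<dots> \<le> exp (- x\<^sup>2 / (2 * w))"
    unfolding equicorrelated_normal_linear_combination(1)[OF model null]
    using assms equicorrelated_normal_linear_combination(2)[OF model null, of a]
    by (intro normal_law_tail_bound) auto
  finally show ?thesis .
qed

section \<open>Splitting off the sample mean\<close>

text \<open>Residual coefficients sum to 0, so the all-ones part of the covariance contributes
  nothing and the variance drops to at most \<open>1 - \<rho>\<close>. Only these smaller variances
  enter the union bound over \<open>n\<close> events; the mean costs a single event.\<close>

lemma FWER_bound:
  assumes model: "equicorrelated_normal M n X \<mu> \<rho>" and null: "global_null n \<mu>"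
    and "n \<ge> 1" "\<rho> \<le> 1" "1 - \<rho> \<le> w" "0 < w" "0 \<le> d" "d \<le> 1"
    and c: "bonferroni_cutoff \<alpha> n \<ge> 0"
  defines "c \<equiv> bonferroni_cutoff \<alpha> n"
  shows "FWER M X n \<alpha> \<le> exp (- ((1 - d) * c)\<^sup>2 / 2) + real n * exp (- (d * c)\<^sup>2 / (2 * w))"
proof -
  interpret prob_space M
    using model by (simp add: equicorrelated_normal_def jointly_normal_def)
  have [measurable]: "X k \<in> borel_measurable M" if "k \<in> {1..n}" for k
    using that model by (auto simp: equicorrelated_normal_def jointly_normal_def)
  \<comment> \<open>Coefficients of the sample mean and of the deviation of \<open>X k\<close> from
    it.\<close>
  define s where "s = (\<lambda>i::nat. 1 / real n)"
  define r where "r = (\<lambda>k i :: nat. (if i = k then 1 else 0) - 1 / real n)"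
  define S where "S = (\<lambda>\<omega>. \<Sum>i\<in>{1..n}. s i * X i \<omega>)"
  define R where "R = (\<lambda>k \<omega>. \<Sum>i\<in>{1..n}. r k i * X i \<omega>)"
  have meas [measurable]: "S \<in> borel_measurable M" "R k \<in> borel_measurable M" for k
    unfolding S_def R_def by measurable
  have split: "X k \<omega> = S \<omega> + R k \<omega>" if "k \<in> {1..n}" for k \<omega>
    using that by (simp add: S_def R_def s_def r_def sum.distrib[symmetric] left_diff_distrib
        if_distrib[of "\<lambda>x. x * _"] cong: if_cong)
  have s1: "(\<Sum>i\<in>{1..n}. s i) = 1" and s2: "(\<Sum>i\<in>{1..n}. (s i)\<^sup>2) = 1 / n"
    using \<open>n \<ge> 1\<close> by (auto simp: s_def power2_eq_square)
  have r1: "(\<Sum>i\<in>{1..n}. r k i) = 0" if "k \<in> {1..n}" for k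
    using that by (simp add: r_def sum_subtractf)
  have r2: "(\<Sum>i\<in>{1..n}. (r k i)\<^sup>2) \<le> 1" if "k \<in> {1..n}" for k
  proof -
    \<comment> \<open>The coefficient at \<open>k\<close> gives (1 - 1/n)^2 = 1 - 2/n + 1/n^2, every
      other one 1/n^2.\<close>
    have "(\<Sum>i\<in>{1..n}. (r k i)\<^sup>2)
        = (\<Sum>i\<in>{1..n}. (if i = k then 1 - 2 / real n else 0) + 1 / (real n)\<^sup>2)"
      by (intro sum.cong) (auto simp: r_def power2_eq_square algebra_simps)
    also have "\<dots> = 1 - 1 / real n"
      using that unfolding sum.distrib by (simp add: power2_eq_square)
    finally show ?thesis by simp
  qed
  have S: "prob {\<omega> \<in> space M. (1 - d) * c < S \<omega>} \<le> exp (- ((1 - d) * c)\<^sup>2 / (2 * 1))"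
    unfolding S_def
  proof (rule equicorrelated_normal_combination_tail[OF model null])
    have "(1 - \<rho>) * (1 / n) \<le> (1 - \<rho>) * 1"
      using assms by (intro mult_left_mono) auto
    then show "(1 - \<rho>) * (\<Sum>i\<in>{1..n}. (s i)\<^sup>2) + \<rho> * (\<Sum>i\<in>{1..n}. s i)\<^sup>2 \<le> 1"
      unfolding s1 s2 by simp
  qed (use assms in auto)
  have R: "prob {\<omega> \<in> space M. d * c < R k \<omega>} \<le> exp (- (d * c)\<^sup>2 / (2 * w))"
    if "k \<in> {1..n}" for k
    unfolding R_def
  proof (rule equicorrelated_normal_combination_tail[OF model null])
    have "(1 - \<rho>) * (\<Sum>i\<in>{1..n}. (r k i)\<^sup>2) \<le> (1 - \<rho>) * 1"
      using assms r2[OF that] by (intro mult_left_mono) auto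
    then show "(1 - \<rho>) * (\<Sum>i\<in>{1..n}. (r k i)\<^sup>2) + \<rho> * (\<Sum>i\<in>{1..n}. r k i)\<^sup>2 \<le> w"
      unfolding r1[OF that] using assms by simp
  qed (use assms in auto)
  have "FWER M X n \<alpha> \<le> prob ({\<omega> \<in> space M. (1 - d) * c < S \<omega>} \<union>
      (\<Union>k\<in>{1..n}. {\<omega> \<in> space M. d * c < R k \<omega>}))"
    unfolding FWER_def c_def[symmetric]
  proof (rule finite_measure_mono)
    show "(\<Union>i\<in>{1..n}. {\<omega> \<in> space M. c < X i \<omega>})
      \<subseteq> {\<omega> \<in> space M. (1 - d) * c < S \<omega>} \<union> (\<Union>k\<in>{1..n}. {\<omega> \<in> space M. d * c < R k \<omega>})"
    proof (intro subsetI; elim UN_E)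
      fix \<omega> k assume k: "k \<in> {1..n}" and "\<omega> \<in> {\<omega> \<in> space M. c < X k \<omega>}"
      then have "\<omega> \<in> space M" "(1 - d) * c + d * c < S \<omega> + R k \<omega>"
        using split[OF k] by (auto simp: algebra_simps)
      then have "(1 - d) * c < S \<omega> \<or> d * c < R k \<omega>" by linarith
      with k \<open>\<omega> \<in> space M\<close> show "\<omega> \<in> {\<omega> \<in> space M. (1 - d) * c < S \<omega>} \<union>
          (\<Union>k\<in>{1..n}. {\<omega> \<in> space M. d * c < R k \<omega>})" by blast
    qed
  qed measurable
  also have "\<dots> \<le> prob {\<omega> \<in> space M. (1 - d) * c < S \<omega>} +
      prob (\<Union>k\<in>{1..n}. {\<omega> \<in> space M. d * c < R k \<omega>})"
    by (intro measure_Un_le) measurable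
  also have "prob (\<Union>k\<in>{1..n}. {\<omega> \<in> space M. d * c < R k \<omega>})
      \<le> (\<Sum>k\<in>{1..n}. prob {\<omega> \<in> space M. d * c < R k \<omega>})"
    by (intro measure_UNION_le) (auto intro: measurable_sets)
  also have "\<dots> \<le> (\<Sum>k\<in>{1..n}. exp (- (d * c)\<^sup>2 / (2 * w)))"
    by (intro sum_mono R)
  finally show ?thesis using S by simp
qed

section \<open>Standard normal tail and growth of the cutoff\<close>

text \<open>The density decreases on the unit interval to the right of \<open>x\<close>, so the mass
  there is at least the value at the right end. Relative to exp(-x^2/2) this loses only the factor
  exp(x + 1/2), up to a constant.\<close>

lemma one_minus_std_normal_cdf_ge:
  assumes "0 \<le> x"
  shows "1 - std_normal_cdf x \<ge> exp (- (x + 1)\<^sup>2 / 2) / sqrt (2 * pi)"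
proof -
  interpret real_distribution std_normal_distribution by (rule real_dist_normal_dist)
  have "ennreal (std_normal_density (x + 1))
      = (\<integral>\<^sup>+t. ennreal (std_normal_density (x + 1)) * indicator {x<..x+1} t \<partial>lborel)"
    by (simp add: nn_integral_cmult_indicator)
  also have "\<dots> \<le> (\<integral>\<^sup>+t. ennreal (std_normal_density t) * indicator {x<..} t \<partial>lborel)"
  proof (rule nn_integral_mono)
    fix t :: real
    have "std_normal_density (x + 1) \<le> std_normal_density t" if "x < t" "t \<le> x + 1"
      using that assms by (auto simp: std_normal_density_def intro!: divide_right_mono power_mono)
    then show "ennreal (std_normal_density (x + 1)) * indicator {x<..x+1} t
        \<le> ennreal (std_normal_density t) * indicator {x<..} t"
      by (auto simp: indicator_def intro!: ennreal_leI)
  qed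
  also have "\<dots> = emeasure std_normal_distribution {x<..}"
    by (simp add: emeasure_density)
  finally have "std_normal_density (x + 1) \<le> measure std_normal_distribution {x<..}"
    by (simp add: emeasure_eq_measure)
  also have "measure std_normal_distribution {x<..} = 1 - std_normal_cdf x"
    using prob_compl[of "{..x}"] by (simp add: std_normal_cdf_def cdf_def Compl_eq_Diff_UNIV[symmetric])
  finally show ?thesis by (simp add: std_normal_density_def)
qed

text \<open>Strictness is what drives the cutoff to infinity: \<open>1 - \<alpha> / n\<close>
  eventually passes every value of the distribution function.\<close>

lemma std_normal_cdf_less_1: "std_normal_cdf x < 1"
proof -
  interpret real_distribution std_normal_distribution by (rule real_dist_normal_dist)
  \<comment> \<open>The tail bound is stated for nonnegative arguments, so a negative
    \<open>x\<close> is first moved up to 0.\<close>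
  have "std_normal_cdf x \<le> std_normal_cdf (max x 0)"
    unfolding std_normal_cdf_def by (intro cdf_nondecreasing) auto
  also have "0 < exp (- (max x 0 + 1)\<^sup>2 / 2) / sqrt (2 * pi)" by simp
  then have "std_normal_cdf (max x 0) < 1"
    using one_minus_std_normal_cdf_ge[of "max x 0"] by linarith
  finally show ?thesis .
qed

text \<open>\<open>inv\<close> selects some preimage, so the point is that one exists: the law has
  no atoms, hence its distribution function is continuous, and the intermediate value theorem
  applies between its limits 0 and 1.\<close>

lemma std_normal_cdf_inverse:
  assumes "0 < y" "y < 1"
  shows "std_normal_cdf (inv std_normal_cdf y) = y"
proof -
  interpret real_distribution std_normal_distribution by (rule real_dist_normal_dist)
  have "emeasure std_normal_distribution {x} = 0" for x
    by (simp add: emeasure_density nn_integral_0_iff_AE AE_iff_null_sets)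
  then have cont: "isCont std_normal_cdf x" for x
    unfolding std_normal_cdf_def isCont_cdf by (simp add: measure_def)
  have "eventually (\<lambda>x. std_normal_cdf x < y) at_bot"
    using order_tendstoD(2)[OF cdf_lim_at_bot] assms unfolding std_normal_cdf_def by auto
  then obtain a where a: "\<And>x. x \<le> a \<Longrightarrow> std_normal_cdf x < y"
    by (auto simp: eventually_at_bot_linorder)
  have "eventually (\<lambda>x. y < std_normal_cdf x) at_top"
    using order_tendstoD(1)[OF cdf_lim_at_top_prob] assms unfolding std_normal_cdf_def by auto
  then obtain b where b: "\<And>x. b \<le> x \<Longrightarrow> y < std_normal_cdf x"
    by (auto simp: eventually_at_top_linorder)
  \<comment> \<open>The right end \<open>max a b\<close> lies beyond \<open>b\<close> and also keeps
    the interval nonempty.\<close>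
  have "\<exists>x\<ge>a. x \<le> max a b \<and> std_normal_cdf x = y"
    using a[of a] b[of "max a b"] cont by (intro IVT) auto
  then show ?thesis by (intro f_inv_into_f) auto
qed

lemma std_normal_cdf_bonferroni_cutoff:
  assumes "0 < \<alpha>" "\<alpha> < 1" "n \<ge> 1"
  shows "std_normal_cdf (bonferroni_cutoff \<alpha> n) = 1 - \<alpha> / real n"
  unfolding bonferroni_cutoff_def
  using assms by (intro std_normal_cdf_inverse) (auto simp: field_simps)

lemma bonferroni_cutoff_at_top:
  assumes "0 < \<alpha>" "\<alpha> < 1"
  shows "filterlim (bonferroni_cutoff \<alpha>) at_top sequentially"
  unfolding filterlim_at_top
proof
  fix K :: real
  interpret real_distribution std_normal_distribution by (rule real_dist_normal_dist)
  have "(\<lambda>n. 1 - \<alpha> / real n) \<longlonglongrightarrow> 1" by real_asymp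
  then have "eventually (\<lambda>n. std_normal_cdf K < 1 - \<alpha> / real n) sequentially"
    by (rule order_tendstoD) (rule std_normal_cdf_less_1)
  with eventually_ge_at_top[of 1] show "eventually (\<lambda>n. K \<le> bonferroni_cutoff \<alpha> n) sequentially"
  proof eventually_elim
    case (elim n)
    then have "std_normal_cdf K < std_normal_cdf (bonferroni_cutoff \<alpha> n)"
      using std_normal_cdf_bonferroni_cutoff[OF assms, of n] by simp
    \<comment> \<open>A cutoff below \<open>K\<close> would, by monotonicity, contradict this strict
      inequality.\<close>
    then show ?case
      using cdf_nondecreasing[of "bonferroni_cutoff \<alpha> n" K] unfolding std_normal_cdf_def
      by (meson linorder_le_cases not_less)
  qed
qed

text \<open>Since \<open>\<alpha> / n\<close> is the upper tail at the cutoff, the lower tail bound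
  can be solved for \<open>n\<close>. This trades the factor \<open>n\<close> of the union bound for
  a function of the cutoff alone.\<close>

lemma sample_size_le_bonferroni_cutoff:
  assumes "0 < \<alpha>" "\<alpha> < 1" "n \<ge> 1" "bonferroni_cutoff \<alpha> n \<ge> 0"
  shows "real n \<le> \<alpha> * sqrt (2 * pi) * exp ((bonferroni_cutoff \<alpha> n + 1)\<^sup>2 / 2)"
  using one_minus_std_normal_cdf_ge[OF assms(4)] assms(1,3)
  unfolding std_normal_cdf_bonferroni_cutoff[OF assms(1-3)]
  by (simp add: exp_minus field_simps)

section \<open>Passage to the limit\<close>

theorem theorem3p1:
  fixes \<alpha> \<rho> :: real
    and M :: "nat \<Rightarrow> 'a measure"
    and X :: "nat \<Rightarrow> nat \<Rightarrow> 'a \<Rightarrow> real"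
    and \<mu> :: "nat \<Rightarrow> nat \<Rightarrow> real"
  assumes "0 < \<alpha>" "\<alpha> < 1"
    and "0 < \<rho>" "\<rho> \<le> 1"
    and model: "\<And>n. n \<ge> 1 \<Longrightarrow> equicorrelated_normal (M n) n (X n) (\<mu> n) \<rho>"
    and null: "\<And>n. n \<ge> 1 \<Longrightarrow> global_null n (\<mu> n)"
  shows "(\<lambda>n. FWER (M n) (X n) n \<alpha>) \<longlonglongrightarrow> 0"
proof -
  \<comment> \<open>Taking \<open>w\<close> strictly above \<open>1 - \<rho>\<close> keeps it positive when \<open>\<rho> = 1\<close>.\<close>
  define w where "w = 1 - \<rho> / 2"
  \<comment> \<open>\<open>d\<close> stays below 1 and still satisfies \<open>w < d\<^sup>2\<close>:
    the difference is \<rho>/4 + \<rho>^2/64.\<close>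
  define d where "d = 1 - \<rho> / 8"
  define q where "q = d\<^sup>2 / w"
  \<comment> \<open>\<open>B\<close> bounds the error rate in terms of the cutoff alone, with
    \<open>n\<close> replaced by its estimate.\<close>
  define B where "B = (\<lambda>c. exp (- ((1 - d) * c)\<^sup>2 / 2) +
    \<alpha> * sqrt (2 * pi) * exp ((c + 1)\<^sup>2 / 2) * exp (- q * c\<^sup>2 / 2))"
  have w: "0 < w" "1 - \<rho> \<le> w" and d: "0 \<le> d" "d < 1"
    using assms by (auto simp: w_def d_def)
  have "w < d\<^sup>2"
    using assms by (simp add: w_def d_def power2_eq_square algebra_simps add_pos_pos)
  then have q: "q > 1" using w by (simp add: q_def)
  \<comment> \<open>Decay rates of the two summands of \<open>B\<close>: the exponents of the second
    combine to c + 1/2 - r c^2, where \<open>q > 1\<close> makes the quadratic term win.\<close>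
  define k where "k = (1 - d)\<^sup>2 / 2"
  define r where "r = (q - 1) / 2"
  have "k > 0" "r > 0"
    using d q by (auto simp: k_def r_def)
  then have "((\<lambda>c::real. exp (- k * c\<^sup>2)) \<longlongrightarrow> 0) at_top"
    "((\<lambda>c::real. exp (c + 1 / 2 - r * c\<^sup>2)) \<longlongrightarrow> 0) at_top"
    by real_asymp+
  then have "((\<lambda>c. exp (- k * c\<^sup>2) + \<alpha> * sqrt (2 * pi) * exp (c + 1 / 2 - r * c\<^sup>2)) \<longlongrightarrow> 0) at_top"
    by (intro tendsto_add_zero tendsto_mult_right_zero)
  also have "(\<lambda>c::real. exp (- k * c\<^sup>2) + \<alpha> * sqrt (2 * pi) * exp (c + 1 / 2 - r * c\<^sup>2)) = B"
  proof
    fix c :: real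
    have "c + 1 / 2 - r * c\<^sup>2 = (c + 1)\<^sup>2 / 2 + - q * c\<^sup>2 / 2"
      by (simp add: r_def power2_eq_square field_simps)
    then show "exp (- k * c\<^sup>2) + \<alpha> * sqrt (2 * pi) * exp (c + 1 / 2 - r * c\<^sup>2) = B c"
      by (simp only: B_def k_def exp_add) (simp add: power_mult_distrib)
  qed
  finally have "(B \<longlongrightarrow> 0) at_top" .
  then have lim: "(\<lambda>n. B (bonferroni_cutoff \<alpha> n)) \<longlonglongrightarrow> 0"
    using bonferroni_cutoff_at_top[OF assms(1,2)] by (rule filterlim_compose)
  have "eventually (\<lambda>n. bonferroni_cutoff \<alpha> n \<ge> 0) sequentially"
    using bonferroni_cutoff_at_top[OF assms(1,2)] by (simp add: filterlim_at_top)
  \<comment> \<open>The model is given from n = 1 on and the bound asks for a nonnegative cutoff;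
    both hold eventually.\<close>
  with eventually_ge_at_top[of 1]
  have "eventually (\<lambda>n. FWER (M n) (X n) n \<alpha> \<le> B (bonferroni_cutoff \<alpha> n)) sequentially"
  proof eventually_elim
    case (elim n)
    let ?c = "bonferroni_cutoff \<alpha> n"
    have "FWER (M n) (X n) n \<alpha>
        \<le> exp (- ((1 - d) * ?c)\<^sup>2 / 2) + real n * exp (- (d * ?c)\<^sup>2 / (2 * w))"
      using elim assms w d by (intro FWER_bound[OF model null]) auto
    also have "exp (- (d * ?c)\<^sup>2 / (2 * w)) = exp (- q * ?c\<^sup>2 / 2)"
      by (simp add: q_def power_mult_distrib)
    also have "real n * exp (- q * ?c\<^sup>2 / 2)
        \<le> \<alpha> * sqrt (2 * pi) * exp ((?c + 1)\<^sup>2 / 2) * exp (- q * ?c\<^sup>2 / 2)"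
      using elim assms by (intro mult_right_mono sample_size_le_bonferroni_cutoff) auto
    finally show ?case by (simp add: B_def)
  qed
  then show ?thesis
    by (intro tendsto_sandwich[OF _ _ tendsto_const lim]) (auto simp: FWER_def)
qed

end
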